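(* Let $H$ be a finite undirected graph (loops allowed). There is a tester for the list $H$-homomorphism problem $\mathsf{LHOM}(H)$ whose number of queries depends only on $\epsilon$ (and $H$) and not on $|V(G)|$, if and only if $H$ is an irreflexive complete bipartite graph or a reflexive complete graph.
   Context: Let $H$ be a finite undirected graph, possibly with loops. For a finite undirected graph $G$ with lists $L(v)\subseteq V(H)$ for $v\in V(G)$, a map $f:V(G)\to V(H)$ is a list-homomorphism if $f(v)\in L(v)$ for all $v$ and $(f(u),f(v))\in E(H)$ whenever $(u,v)\in E(G)$. An input to $\mathsf{LHOM}(H)$ is $(G,L,\boldsymbol{w},f)$ where $\boldsymbol{w}:V(G)\to\mathbb{R}_{\ge 0}$ is a weight function with $\sum_v \boldsymbol{w}(v)=1$ and $f:V(G)\to V(H)$ is accessible only through an oracle returning $f(v)$ on query $v$. The distance between maps $f,f'$ is $\mathrm{dist}(f,f')=\Pr_{v\sim\boldsymbol{w}}[f(v)\ne f'(v)]$ (where $v\sim\boldsymbol{w}$ means $v$ is drawn with probability $\boldsymbol{w}(v)$), and $\mathrm{dist}_H(f)$ is the minimum of $\mathrm{dist}(f,f')$ over list-homomorphisms $f'$; $f$ is $\epsilon$-far if $\mathrm{dist}_H(f)\ge\epsilon$. A tester for $\mathsf{LHOM}(H)$ is a randomized algorithm that, given $\epsilon>0$ and oracle access to $f$ (with $G,L,\boldsymbol{w}$ known), accepts with probability at least $2/3$ when $f$ is a list-homomorphism and rejects with probability at least $2/3$ when $f$ is $\epsilon$-far. Its query complexity is the number of oracle queries, measured as a function of $n=|V(G)|$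 (and $\epsilon$). A graph is reflexive if every vertex has a loop and irreflexive if no vertex has a loop.
   Formalization: The "only if" direction is stated for connected H only, since it fails otherwise (e.g. a looped vertex plus an isolated loopless vertex is testable with O(1/ε) queries); the "if" direction holds for all finite H. A complete bipartite graph may have an empty part. *)

theory Defs
  imports "HOL-Probability.Probability"
begin

text \<open>Undirected edges are symmetric pairs; \<open>(v, v)\<close> is a loop at \<open>v\<close>.\<close>

record 'a ugraph =
  verts :: "'a set"
  edges :: "('a \<times> 'a) set"

definition finite_ugraph :: "'a ugraph \<Rightarrow> bool" where
  "finite_ugraph G \<longleftrightarrow> finite (verts G) \<and> edges G \<subseteq> verts G \<times> verts G \<and> sym (edges G)"

definition reflexive_graph :: "'a ugraph \<Rightarrow> bool" where
  "reflexive_graph H \<longleftrightarrow> (\<forall>v\<in>verts H. (v, v) \<in> edges H)"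

definition irreflexive_graph :: "'a ugraph \<Rightarrow> bool" where
  "irreflexive_graph H \<longleftrightarrow> (\<forall>v\<in>verts H. (v, v) \<notin> edges H)"

definition complete_ugraph :: "'a ugraph \<Rightarrow> bool" where
  "complete_ugraph H \<longleftrightarrow> (\<forall>u\<in>verts H. \<forall>v\<in>verts H. u \<noteq> v \<longrightarrow> (u, v) \<in> edges H)"

text \<open>A part may be empty, so that a single vertex without a loop is complete bipartite.\<close>

definition complete_bipartite_graph :: "'a ugraph \<Rightarrow> bool" where
  "complete_bipartite_graph H \<longleftrightarrow>
     (\<exists>A B. A \<union> B = verts H \<and> A \<inter> B = {} \<and> edges H = A \<times> B \<union> B \<times> A)"

text \<open>
  Connectedness is needed for one direction of the classification: if \<open>H\<close> is the disjoint union
  of a vertex with a loop and a vertex without a loop, then being a list-homomorphism is a condition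
  on each value \<open>f v\<close> separately, so sampling \<open>O(1/\<epsilon>)\<close> vertices is a tester, but \<open>H\<close> is neither
  reflexive nor irreflexive.
\<close>

definition connected_graph :: "'a ugraph \<Rightarrow> bool" where
  "connected_graph H \<longleftrightarrow> (\<forall>u\<in>verts H. \<forall>v\<in>verts H. (u, v) \<in> (edges H)\<^sup>*)"

definition list_hom ::
  "'h ugraph \<Rightarrow> 'v ugraph \<Rightarrow> ('v \<Rightarrow> 'h set) \<Rightarrow> ('v \<Rightarrow> 'h) \<Rightarrow> bool" where
  "list_hom H G L f \<longleftrightarrow>
     f \<in> verts G \<rightarrow> verts H \<and>
     (\<forall>v\<in>verts G. f v \<in> L v) \<and>
     (\<forall>(u, v)\<in>edges G. (f u, f v) \<in> edges H)"

text \<open>The part \<open>(G, L, w)\<close> of an input that is known to the tester.\<close>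

definition lhom_instance ::
  "'h ugraph \<Rightarrow> 'v ugraph \<Rightarrow> ('v \<Rightarrow> 'h set) \<Rightarrow> ('v \<Rightarrow> real) \<Rightarrow> bool" where
  "lhom_instance H G L w \<longleftrightarrow>
     finite_ugraph G \<and>
     (\<forall>v\<in>verts G. L v \<subseteq> verts H) \<and>
     (\<forall>v\<in>verts G. 0 \<le> w v) \<and> (\<Sum>v\<in>verts G. w v) = 1"

definition map_dist :: "'v ugraph \<Rightarrow> ('v \<Rightarrow> real) \<Rightarrow> ('v \<Rightarrow> 'h) \<Rightarrow> ('v \<Rightarrow> 'h) \<Rightarrow> real" where
  "map_dist G w f f' = (\<Sum>v\<in>{v \<in> verts G. f v \<noteq> f' v}. w v)"

text \<open>The infimum is a minimum when a list-homomorphism exists, and \<open>\<infinity>\<close> when none exists.\<close>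

definition dist_to_hom ::
  "'h ugraph \<Rightarrow> 'v ugraph \<Rightarrow> ('v \<Rightarrow> 'h set) \<Rightarrow> ('v \<Rightarrow> real) \<Rightarrow> ('v \<Rightarrow> 'h) \<Rightarrow> ereal" where
  "dist_to_hom H G L w f = (INF f'\<in>{f'. list_hom H G L f'}. ereal (map_dist G w f f'))"

definition far_from_hom ::
  "'h ugraph \<Rightarrow> 'v ugraph \<Rightarrow> ('v \<Rightarrow> 'h set) \<Rightarrow> ('v \<Rightarrow> real) \<Rightarrow> real \<Rightarrow> ('v \<Rightarrow> 'h) \<Rightarrow> bool" where
  "far_from_hom H G L w \<epsilon> f \<longleftrightarrow> ereal \<epsilon> \<le> dist_to_hom H G L w f"

text \<open>
  Deterministic adaptive query algorithms: either stop and accept (\<open>True\<close>) or reject (\<open>False\<close>),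
  or query the oracle at a vertex and continue depending on the answer.  A randomized algorithm
  is a probability distribution over them (the random coins are tossed in advance).
\<close>

datatype ('v, 'h) query_alg =
    Output bool
  | Query 'v "'h \<Rightarrow> ('v, 'h) query_alg"

primrec run :: "('v, 'h) query_alg \<Rightarrow> ('v \<Rightarrow> 'h) \<Rightarrow> bool" where
  "run (Output b) f = b"
| "run (Query v k) f = run (k (f v)) f"

primrec queries :: "('v, 'h) query_alg \<Rightarrow> ('v \<Rightarrow> 'h) \<Rightarrow> 'v list" where
  "queries (Output b) f = []"
| "queries (Query v k) f = v # queries (k (f v)) f"

text \<open>The randomized algorithm may depend on \<open>\<epsilon>\<close> and on \<open>G, L, w\<close>, but on \<open>f\<close> only via queries.\<close>

type_synonym ('v, 'h) tester =
  "real \<Rightarrow> 'v ugraph \<Rightarrow> ('v \<Rightarrow> 'h set) \<Rightarrow> ('v \<Rightarrow> real) \<Rightarrow> ('v, 'h) query_alg pmf"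

definition lhom_tester :: "'h ugraph \<Rightarrow> ('v, 'h) tester \<Rightarrow> bool" where
  "lhom_tester H T \<longleftrightarrow>
     (\<forall>\<epsilon> G L w f. 0 < \<epsilon> \<longrightarrow> lhom_instance H G L w \<longrightarrow> f \<in> verts G \<rightarrow> verts H \<longrightarrow>
        (\<forall>A\<in>set_pmf (T \<epsilon> G L w). set (queries A f) \<subseteq> verts G) \<and>
        (list_hom H G L f \<longrightarrow> measure_pmf.prob (T \<epsilon> G L w) {A. run A f} \<ge> 2 / 3) \<and>
        (far_from_hom H G L w \<epsilon> f \<longrightarrow> measure_pmf.prob (T \<epsilon> G L w) {A. \<not> run A f} \<ge> 2 / 3))"

definition query_bound :: "'h ugraph \<Rightarrow> ('v, 'h) tester \<Rightarrow> (real \<Rightarrow> nat) \<Rightarrow> bool" where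
  "query_bound H T q \<longleftrightarrow>
     (\<forall>\<epsilon> G L w f. 0 < \<epsilon> \<longrightarrow> lhom_instance H G L w \<longrightarrow> f \<in> verts G \<rightarrow> verts H \<longrightarrow>
        (\<forall>A\<in>set_pmf (T \<epsilon> G L w). length (queries A f) \<le> q \<epsilon>))"

text \<open>Every finite graph \<open>G\<close> is isomorphic to one whose vertices are natural numbers.\<close>

definition constant_query_testable :: "'h ugraph \<Rightarrow> bool" where
  "constant_query_testable H \<longleftrightarrow>
     (\<exists>(T :: (nat, 'h) tester) q. lhom_tester H T \<and> query_bound H T q)"

end

theory Submission
  imports Defs "HOL-Library.Nat_Bijection"
begin

text \<open>
  Call \<open>H\<close> rectangular if \<open>a - b - c - d\<close> implies \<open>a - d\<close>. For connected \<open>H\<close> this means being an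
  irreflexive complete bipartite or a reflexive complete graph, and rectangularity is equivalent to
  testability with constantly many queries.

  If \<open>H\<close> is rectangular, two list-homomorphisms that agree at one vertex can be mixed freely on its
  component. So the tester draws \<open>u\<close> from \<open>w\<close> and \<open>v\<close> from \<open>w\<close> conditioned on the component of \<open>u\<close>,
  and rejects if no list-homomorphism agrees with \<open>f\<close> at both. Correcting each component at the
  vertices \<open>u\<close> in conflict with its best pivot \<open>v\<close> shows that the rejection probability is at least
  the distance of \<open>f\<close> to the list-homomorphisms.

  If \<open>a - b - c - d\<close> but not \<open>a - d\<close>, the lists \<open>{a, c}\<close> and \<open>{b, d}\<close> on the two ends of an edge encode
  an implication. In the cube of dimension \<open>s\<close>, doubled to a bipartite graph, the edges of each
  direction form an induced matching. For a random direction, put \<open>(a, b)\<close> or \<open>(c, d)\<close> at random on the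
  edges of its matching, or alternatively \<open>(a, d)\<close> or \<open>(c, b)\<close>. The two distributions can only be
  told apart by querying both ends of an edge of the random direction, and the decision tree of an
  algorithm with \<open>k\<close> queries meets at most \<open>4 ^ k\<close> directions in this way.
\<close>

section \<open>Rectangular graphs and the classification of the connected ones\<close>

definition rectangular :: "'a ugraph \<Rightarrow> bool" where
  "rectangular H \<longleftrightarrow>
     (\<forall>a b c d. (a, b) \<in> edges H \<longrightarrow> (b, c) \<in> edges H \<longrightarrow> (c, d) \<in> edges H \<longrightarrow> (a, d) \<in> edges H)"

lemma rectangularD:
  "rectangular H \<Longrightarrow> (a, b) \<in> edges H \<Longrightarrow> (b, c) \<in> edges H \<Longrightarrow> (c, d) \<in> edges H \<Longrightarrow> (a, d) \<in> edges H"
  unfolding rectangular_def by blast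

lemma complete_bipartite_imp_rectangular:
  "complete_bipartite_graph H \<Longrightarrow> rectangular H"
  unfolding complete_bipartite_graph_def rectangular_def by blast

lemma reflexive_complete_imp_rectangular:
  assumes "finite_ugraph H" "reflexive_graph H" "complete_ugraph H"
  shows "rectangular H"
proof -
  have "edges H \<subseteq> verts H \<times> verts H" using assms(1) unfolding finite_ugraph_def by blast
  moreover have "(u, v) \<in> edges H" if "u \<in> verts H" "v \<in> verts H" for u v
    using assms(2,3) that unfolding reflexive_graph_def complete_ugraph_def by (cases "u = v") auto
  ultimately have "edges H = verts H \<times> verts H" by auto
  then show ?thesis unfolding rectangular_def by blast
qed

text \<open>The neighbours of \<open>v\<close> are closed under adjacency:
  \<open>z - y - v - v\<close> gives \<open>z - v\<close>. Hence every vertex is adjacent to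
  \<open>v\<close>, and \<open>u - v - v - u'\<close> gives \<open>u - u'\<close>, loops
  included.\<close>

lemma connected_rectangular_with_loop:
  assumes H: "finite_ugraph H" "connected_graph H" "rectangular H" and v: "(v, v) \<in> edges H"
  shows "reflexive_graph H \<and> complete_ugraph H"
proof -
  have sym: "(x, y) \<in> edges H \<Longrightarrow> (y, x) \<in> edges H" for x y
    using H(1) unfolding finite_ugraph_def by (meson symD)
  have adj: "(u, v) \<in> edges H" if "(v, u) \<in> (edges H)\<^sup>*" for u
    using that
  proof (induction rule: rtrancl_induct)
    case (step y z)
    then show ?case using rectangularD[OF H(3)] sym v by blast
  qed (rule v)
  have "v \<in> verts H" using H(1) v unfolding finite_ugraph_def by blast
  then have "(u, v) \<in> edges H" if "u \<in> verts H" for u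
    using adj H(2) that unfolding connected_graph_def by blast
  then have "(u, u') \<in> edges H" if "u \<in> verts H" "u' \<in> verts H" for u u'
    using rectangularD[OF H(3)] sym v that by blast
  then show ?thesis unfolding reflexive_graph_def complete_ugraph_def by blast
qed

text \<open>The parts are the neighbours \<open>B\<close> of a fixed vertex \<open>v\<close> and the
  rest \<open>A\<close>, which consists of \<open>v\<close> and vertices at distance two. An edge
  \<open>x - y\<close> inside \<open>B\<close> closes to \<open>v - x - y - v\<close> and forces a
  loop at \<open>v\<close>; an edge inside \<open>A\<close> would make one of its ends a neighbour
  of \<open>v\<close>.\<close>

lemma connected_rectangular_without_loop:
  assumes H: "finite_ugraph H" "connected_graph H" "rectangular H" "irreflexive_graph H"
  shows "complete_bipartite_graph H"
proof (cases "verts H = {}")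
  case True
  then have "edges H = {}" using H(1) unfolding finite_ugraph_def by blast
  with True show ?thesis unfolding complete_bipartite_graph_def by blast
next
  case False
  then obtain v where v: "v \<in> verts H" by blast
  have sym: "(x, y) \<in> edges H \<Longrightarrow> (y, x) \<in> edges H" for x y
    using H(1) unfolding finite_ugraph_def by (meson symD)
  have sub: "edges H \<subseteq> verts H \<times> verts H" using H(1) unfolding finite_ugraph_def by blast
  have noloop: "(x, x) \<notin> edges H" for x
    using H(4) sub unfolding irreflexive_graph_def by blast
  \<comment> \<open>Walks to \<open>v\<close> shorten to length at most two, as a walk of length
    three collapses to an edge.\<close>
  have "(u, v) \<in> edges H \<or> u = v \<or> (\<exists>t. (u, t) \<in> edges H \<and> (t, v) \<in> edges H)"
    if "(v, u) \<in> (edges H)\<^sup>*" for u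
    using that
  proof (induction rule: rtrancl_induct)
    case (step y z)
    then show ?case using rectangularD[OF H(3)] sym by blast
  qed blast
  then have near: "(u, v) \<in> edges H \<or> u = v \<or> (\<exists>t. (u, t) \<in> edges H \<and> (t, v) \<in> edges H)"
    if "u \<in> verts H" for u
    using H(2) v that unfolding connected_graph_def by blast
  define A where "A = {u \<in> verts H. (u, v) \<notin> edges H}"
  define B where "B = {u \<in> verts H. (u, v) \<in> edges H}"
  have AB: "(x, y) \<in> edges H" if "x \<in> A" "y \<in> B" for x y
    using that near[of x] rectangularD[OF H(3)] sym unfolding A_def B_def by blast
  have BB: "(x, y) \<notin> edges H" if "x \<in> B" "y \<in> B" for x y
    using that rectangularD[OF H(3)] sym noloop[of v] unfolding B_def by blast
  have AA: "(x, y) \<notin> edges H" if "x \<in> A" "y \<in> A" for x y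
    using that near[of x] rectangularD[OF H(3)] sym unfolding A_def by blast
  have "A \<union> B = verts H" "A \<inter> B = {}" unfolding A_def B_def by blast+
  moreover from this have "edges H = A \<times> B \<union> B \<times> A"
  proof (intro equalityI subrelI)
    fix x y assume xy: "(x, y) \<in> edges H"
    then have "x \<in> A \<union> B" "y \<in> A \<union> B" using sub \<open>A \<union> B = verts H\<close> by auto
    then show "(x, y) \<in> A \<times> B \<union> B \<times> A" using AA BB xy by auto
  qed (use AB sym in auto)
  ultimately show ?thesis unfolding complete_bipartite_graph_def by blast
qed

lemma connected_rectangular_classification:
  assumes "finite_ugraph H" "connected_graph H" "rectangular H"
  shows "(irreflexive_graph H \<and> complete_bipartite_graph H) \<or> (reflexive_graph H \<and> complete_ugraph H)"
proof (cases "irreflexive_graph H")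
  case True
  then show ?thesis using connected_rectangular_without_loop[OF assms] by blast
next
  case False
  then obtain v where "(v, v) \<in> edges H" unfolding irreflexive_graph_def by blast
  then show ?thesis using connected_rectangular_with_loop[OF assms] by blast
qed

section \<open>Rectangular graphs are testable with constantly many queries\<close>

text \<open>Both crossings are needed to push the induction along the walk from \<open>x\<close> to \<open>y\<close>.\<close>

lemma list_homs_cross:
  assumes H: "rectangular H" and G: "finite_ugraph G"
    and g: "list_hom H G L g" and g': "list_hom H G L g'" and x: "g x = g' x"
    and xy: "(x, y) \<in> (edges G)\<^sup>*" and yz: "(y, z) \<in> edges G"
  shows "(g y, g' z) \<in> edges H"
proof -
  have sym: "(x, y) \<in> edges G \<Longrightarrow> (y, x) \<in> edges G" for x y
    using G unfolding finite_ugraph_def by (meson symD)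
  have e: "(u, v) \<in> edges G \<Longrightarrow> (g u, g v) \<in> edges H"
    and e': "(u, v) \<in> edges G \<Longrightarrow> (g' u, g' v) \<in> edges H" for u v
    using g g' unfolding list_hom_def by blast+
  have "\<forall>z. (y, z) \<in> edges G \<longrightarrow> (g y, g' z) \<in> edges H \<and> (g' y, g z) \<in> edges H"
    using xy
  proof (induction rule: rtrancl_induct)
    case base
    then show ?case using e e' x by metis
  next
    case (step y t)
    have "(g t, g' y) \<in> edges H" "(g' t, g y) \<in> edges H"
      if "(g y, g' t) \<in> edges H" "(g' y, g t) \<in> edges H"
      using rectangularD[OF H] e e' sym step.hyps that by meson+
    \<comment> \<open>The chord comes from the walk \<open>g t - g' y - g' t - g' z\<close>, and
      likewise with \<open>g\<close> and \<open>g'\<close> exchanged.\<close>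
    then show ?case
      using rectangularD[OF H] e e' step by meson
  qed
  with yz show ?thesis by blast
qed

section \<open>Components and repair of a map from pivots\<close>

definition component :: "'v ugraph \<Rightarrow> 'v \<Rightarrow> 'v set" where
  "component G u = {v \<in> verts G. (u, v) \<in> (edges G)\<^sup>*}"

lemma self_in_component: "u \<in> verts G \<Longrightarrow> u \<in> component G u"
  unfolding component_def by blast

lemma component_eq:
  assumes "finite_ugraph G" "v \<in> component G u"
  shows "component G v = component G u"
proof -
  have "sym ((edges G)\<^sup>*)" using assms(1) unfolding finite_ugraph_def by (simp add: sym_rtrancl)
  moreover have "(u, v) \<in> (edges G)\<^sup>*" using assms(2) unfolding component_def by blast
  ultimately show ?thesis unfolding component_def by (auto dest: symD intro: rtrancl_trans)
qed

lemma component_sym: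
  assumes "finite_ugraph G" "u \<in> verts G" "v \<in> component G u"
  shows "u \<in> component G v"
  using component_eq[OF assms(1,3)] self_in_component[OF assms(2)] by simp

text \<open>The check made on the answers \<open>a\<close> and \<open>b\<close> to queries at
  \<open>u\<close> and \<open>v\<close>. It involves only the known part of the input.\<close>

definition extendable ::
  "'h ugraph \<Rightarrow> 'v ugraph \<Rightarrow> ('v \<Rightarrow> 'h set) \<Rightarrow> 'v \<Rightarrow> 'v \<Rightarrow> 'h \<Rightarrow> 'h \<Rightarrow> bool" where
  "extendable H G L u v a b \<longleftrightarrow> (\<exists>g. list_hom H G L g \<and> g u = a \<and> g v = b)"

text \<open>The pivot \<open>m\<close> is constant on components. All the list-homomorphisms from which the repaired
  map is assembled agree at the pivot, hence fit together along edges.\<close>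

lemma repair_from_pivots:
  assumes H: "rectangular H" and G: "finite_ugraph G" and ex: "list_hom H G L g0"
    and m: "\<And>u. u \<in> verts G \<Longrightarrow> m u \<in> component G u"
    and m_edge: "\<And>u v. (u, v) \<in> edges G \<Longrightarrow> m u = m v"
  obtains g where "list_hom H G L g"
    "\<And>u. extendable H G L u (m u) (f u) (f (m u)) \<Longrightarrow> g u = f u"
proof -
  \<comment> \<open>\<open>h x\<close> agrees with \<open>f\<close> at \<open>x\<close> whenever
    some list-homomorphism does; the fallback \<open>g0\<close> keeps it a list-homomorphism in all
    cases.\<close>
  define h where "h x = (if \<exists>g. list_hom H G L g \<and> g x = f x
    then SOME g. list_hom H G L g \<and> g x = f x else g0)" for x
  have h: "list_hom H G L (h x)" for x
    using ex someI_ex[of "\<lambda>g. list_hom H G L g \<and> g x = f x"] unfolding h_def by auto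
  have h': "h x x = f x" if "list_hom H G L g" "g x = f x" for x g
    using someI_ex[of "\<lambda>g. list_hom H G L g \<and> g x = f x"] that unfolding h_def by auto
  \<comment> \<open>A witness of extendability agrees with \<open>f\<close> at the pivot, and then
    so does \<open>h (m u)\<close>; the witness can serve as \<open>k\<close>. Otherwise
    \<open>h (m u)\<close> itself serves.\<close>
  have "\<exists>k. list_hom H G L k \<and> k (m u) = h (m u) (m u) \<and>
      (extendable H G L u (m u) (f u) (f (m u)) \<longrightarrow> k u = f u)" for u
    using h h' unfolding extendable_def by metis
  then obtain k where k: "list_hom H G L (k u)" "k u (m u) = h (m u) (m u)"
    "extendable H G L u (m u) (f u) (f (m u)) \<Longrightarrow> k u u = f u" for u
    by metis
  have "(k u u, k v v) \<in> edges H" if uv: "(u, v) \<in> edges G" for u v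
  proof (rule list_homs_cross[OF H G k(1) k(1) _ _ uv])
    show "k u (m u) = k v (m u)" using k(2) m_edge[OF uv] by metis
    have "u \<in> verts G" using G uv unfolding finite_ugraph_def by blast
    then have "u \<in> component G (m u)" using component_sym[OF G] m by blast
    then show "(m u, u) \<in> (edges G)\<^sup>*" unfolding component_def by blast
  qed
  then have "list_hom H G L (\<lambda>u. k u u)"
    using k(1) unfolding list_hom_def by fastforce
  then show ?thesis using that k(3) by blast
qed

lemma sum_component_swap:
  fixes F :: "'v \<Rightarrow> 'v \<Rightarrow> 'b::comm_monoid_add"
  assumes "finite_ugraph G"
  shows "(\<Sum>u\<in>verts G. \<Sum>v\<in>component G u. F u v) = (\<Sum>v\<in>verts G. \<Sum>u\<in>component G v. F u v)"
proof -
  have fin: "finite (verts G)" using assms unfolding finite_ugraph_def by blast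
  have 1: "component G u = {v \<in> verts G. v \<in> component G u}" for u
    unfolding component_def by blast
  have "component G v = {u \<in> verts G. v \<in> component G u}" if "v \<in> verts G" for v
    using component_sym[OF assms] that unfolding component_def[of G v]
    by (auto simp: component_def)
  then show ?thesis
    using sum.swap_restrict[OF fin fin, of F "\<lambda>u v. v \<in> component G u"] 1
    by (smt (verit, ccfv_SIG) sum.cong)
qed

definition component_weight :: "'v ugraph \<Rightarrow> ('v \<Rightarrow> real) \<Rightarrow> 'v \<Rightarrow> real" where
  "component_weight G w u = (\<Sum>v\<in>component G u. w v)"

lemma component_weight_cancel:
  assumes G: "finite_ugraph G" and w: "\<And>v. v \<in> verts G \<Longrightarrow> 0 \<le> w v" and u: "u \<in> verts G"
  shows "(\<Sum>v\<in>component G u. w v / component_weight G w u * w u) = w u"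
proof -
  have fin: "finite (component G u)" using G unfolding finite_ugraph_def component_def by simp
  have pos: "\<And>v. v \<in> component G u \<Longrightarrow> 0 \<le> w v" using w unfolding component_def by blast
  \<comment> \<open>In a component of weight zero the quotients are 0 by convention, which is the
    right value because \<open>w u\<close> vanishes too.\<close>
  have "component_weight G w u = 0 \<Longrightarrow> w u = 0"
    using sum_nonneg_eq_0_iff[of "component G u" w, OF fin pos] self_in_component[OF u] unfolding component_weight_def by blast
  moreover have "(\<Sum>v\<in>component G u. w v / component_weight G w u * w u) =
      component_weight G w u / component_weight G w u * w u"
    unfolding component_weight_def sum_divide_distrib sum_distrib_right ..
  ultimately show ?thesis by (cases "component_weight G w u = 0") simp_all
qed

text \<open>The right-hand side is the probability that one round of the tester rejects. The
  repaired map differs from \<open>f\<close> only at vertices in conflict with the pivot of their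
  component. The pivot minimises the weight \<open>d\<close> of the conflicting vertices, so this
  minimum is at most the average of \<open>d\<close> over a random \<open>v\<close> in the
  component.\<close>

lemma pivot_rejections_ge_distance:
  assumes H: "rectangular H" and inst: "lhom_instance H G L w" and ex: "list_hom H G L g0"
    and far: "far_from_hom H G L w \<epsilon> f"
  shows "\<epsilon> \<le> (\<Sum>u\<in>verts G. \<Sum>v\<in>component G u. w u * w v / component_weight G w u *
            of_bool (\<not> extendable H G L u v (f u) (f v)))"
proof -
  have G: "finite_ugraph G" and w: "\<And>v. v \<in> verts G \<Longrightarrow> 0 \<le> w v"
    using inst unfolding lhom_instance_def by blast+
  have finV: "finite (verts G)" and EV: "edges G \<subseteq> verts G \<times> verts G"
    using G unfolding finite_ugraph_def by blast+
  have sub: "component G u \<subseteq> verts G" for u unfolding component_def by blast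
  have fin: "finite (component G u)" for u using finV sub finite_subset by blast
  let ?W = "component_weight G w"
  define rej :: "'b \<Rightarrow> 'b \<Rightarrow> real" where
    "rej u v = of_bool (\<not> extendable H G L u v (f u) (f v))" for u v
  define d where "d v = (\<Sum>u\<in>component G v. w u * rej u v)" for v
  \<comment> \<open>The minimiser is a function of the component as a set, so it is the same for all
    vertices of a component.\<close>
  define m where "m u = arg_min_on d (component G u)" for u
  have ne: "u \<in> verts G \<Longrightarrow> component G u \<noteq> {}" for u using self_in_component by fast
  have m: "m u \<in> component G u" if "u \<in> verts G" for u
    unfolding m_def using arg_min_if_finite(1)[OF fin ne[OF that]] .
  have m_le: "d (m u) \<le> d u" if "u \<in> verts G" for u
    unfolding m_def by (rule arg_min_least[OF fin ne[OF that] self_in_component[OF that]])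
  have m_eq: "m u = m v" if "v \<in> component G u" for u v
    unfolding m_def using component_eq[OF G that] by simp
  have W_eq: "?W u = ?W v" if "v \<in> component G u" for u v
    unfolding component_weight_def using component_eq[OF G that] by simp
  have "m u = m v" if "(u, v) \<in> edges G" for u v
    by (rule m_eq) (use that EV in \<open>auto simp: component_def\<close>)
  from repair_from_pivots[OF H G ex m this, of f] obtain g where g: "list_hom H G L g"
    and gf: "\<And>u. extendable H G L u (m u) (f u) (f (m u)) \<Longrightarrow> g u = f u" by blast
  have W0: "0 \<le> ?W v" for v
    unfolding component_weight_def using w sub by (meson subsetD sum_nonneg)
  have "ereal \<epsilon> \<le> ereal (map_dist G w f g)"
    using far g unfolding far_from_hom_def dist_to_hom_def
    by (metis (no_types, lifting) INF_lower2 mem_Collect_eq order_refl order_trans)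
  then have "\<epsilon> \<le> map_dist G w f g" by simp
  also have "\<dots> \<le> (\<Sum>u\<in>verts G. w u * rej u (m u))"
  proof -
    have "map_dist G w f g = (\<Sum>u\<in>verts G. if f u \<noteq> g u then w u else 0)"
      unfolding map_dist_def using finV by (simp add: sum.inter_filter)
    also have "\<dots> \<le> (\<Sum>u\<in>verts G. w u * rej u (m u))"
      by (rule sum_mono) (use gf w in \<open>auto simp: rej_def\<close>)
    finally show ?thesis .
  qed
  \<comment> \<open>The factor \<open>w u\<close> is spread over the component in proportion to the
    weights; this introduces the random vertex \<open>v\<close>.\<close>
  also have "\<dots> = (\<Sum>u\<in>verts G. (\<Sum>v\<in>component G u. w v / ?W u * w u) * rej u (m u))"
    using component_weight_cancel[of G w, OF G w] by simp
  also have "\<dots> = (\<Sum>u\<in>verts G. \<Sum>v\<in>component G u. w v / ?W u * w u * rej u (m u))"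
    by (simp add: sum_distrib_right)
  also have "\<dots> = (\<Sum>u\<in>verts G. \<Sum>v\<in>component G u. w v / ?W v * w u * rej u (m v))"
    by (intro sum.cong refl) (metis m_eq W_eq)
  also have "\<dots> = (\<Sum>v\<in>verts G. \<Sum>u\<in>component G v. w v / ?W v * w u * rej u (m v))"
    by (rule sum_component_swap[OF G])
  also have "\<dots> = (\<Sum>v\<in>verts G. w v / ?W v * d (m v))"
  proof (rule sum.cong[OF refl])
    fix v assume "v \<in> verts G"
    then have "component G (m v) = component G v" using component_eq[OF G] m by blast
    then show "(\<Sum>u\<in>component G v. w v / ?W v * w u * rej u (m v)) = w v / ?W v * d (m v)"
      unfolding d_def by (simp add: sum_distrib_left mult.assoc)
  qed
  \<comment> \<open>The only place where minimality of the pivot enters.\<close>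
  also have "\<dots> \<le> (\<Sum>v\<in>verts G. w v / ?W v * d v)"
    by (intro sum_mono mult_left_mono m_le) (use w W0 in auto)
  also have "\<dots> = (\<Sum>v\<in>verts G. \<Sum>u\<in>component G v. w u * w v / ?W v * rej u v)"
    unfolding d_def by (intro sum.cong refl) (simp add: sum_distrib_left mult_ac)
  also have "\<dots> = (\<Sum>u\<in>verts G. \<Sum>v\<in>component G u. w u * w v / ?W v * rej u v)"
    by (rule sum_component_swap[OF G, symmetric])
  also have "\<dots> = (\<Sum>u\<in>verts G. \<Sum>v\<in>component G u. w u * w v / ?W u * rej u v)"
    by (intro sum.cong refl) (metis W_eq)
  finally show ?thesis unfolding rej_def .
qed

section \<open>The tester: random pairs within a component\<close>

text \<open>The law of \<open>u\<close> drawn from \<open>w\<close> followed by \<open>v\<close>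
  drawn from \<open>w\<close> conditioned on the component of \<open>u\<close>. With an explicit
  density, rejection probabilities are finite sums of the form bounded above.\<close>

definition component_pair_pmf :: "'v ugraph \<Rightarrow> ('v \<Rightarrow> real) \<Rightarrow> ('v \<times> 'v) pmf" where
  "component_pair_pmf G w = embed_pmf (\<lambda>(u, v).
     if u \<in> verts G \<and> v \<in> component G u then w u * w v / component_weight G w u else 0)"

lemma pmf_component_pair:
  assumes inst: "lhom_instance H G L w"
  shows "pmf (component_pair_pmf G w) = (\<lambda>(u, v).
     if u \<in> verts G \<and> v \<in> component G u then w u * w v / component_weight G w u else 0)"
    (is "_ = ?p")
proof -
  have G: "finite_ugraph G" and w: "\<And>v. v \<in> verts G \<Longrightarrow> 0 \<le> w v" and w1: "(\<Sum>v\<in>verts G. w v) = 1"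
    using inst unfolding lhom_instance_def by blast+
  have finV: "finite (verts G)" using G unfolding finite_ugraph_def by blast
  have sub: "component G u \<subseteq> verts G" for u unfolding component_def by blast
  have fin: "finite (component G u)" for u using finV sub finite_subset by blast
  have W0: "0 \<le> component_weight G w v" for v
    unfolding component_weight_def using w sub by (meson subsetD sum_nonneg)
  have p0: "0 \<le> ?p x" for x
    using w W0 sub by (auto split: prod.split intro!: divide_nonneg_nonneg mult_nonneg_nonneg)
  let ?A = "SIGMA u:verts G. component G u"
  have finA: "finite ?A" using finV fin by blast
  have "(\<integral>\<^sup>+x. ennreal (?p x) \<partial>count_space UNIV) = (\<Sum>x\<in>?A. ennreal (?p x))"
    by (rule nn_integral_count_space'[OF finA]) (auto split: if_split_asm)
  also have "\<dots> = ennreal (\<Sum>x\<in>?A. ?p x)" using p0 by (simp add: sum_ennreal)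
  also have "(\<Sum>x\<in>?A. ?p x) =
      (\<Sum>u\<in>verts G. \<Sum>v\<in>component G u. w v / component_weight G w u * w u)"
    using finV fin by (subst sum.Sigma) (auto intro!: sum.cong)
  also have "\<dots> = 1" using component_weight_cancel[of G w, OF G w] w1 by simp
  finally show ?thesis unfolding component_pair_pmf_def
    using p0 by (intro ext pmf_embed_pmf) auto
qed

primrec pair_checks :: "('v \<Rightarrow> 'v \<Rightarrow> 'h \<Rightarrow> 'h \<Rightarrow> bool) \<Rightarrow> ('v \<times> 'v) list \<Rightarrow> ('v, 'h) query_alg" where
  "pair_checks C [] = Output True"
| "pair_checks C (p # ps) = Query (fst p) (\<lambda>a. Query (snd p) (\<lambda>b.
     if C (fst p) (snd p) a b then pair_checks C ps else Output False))"

lemma run_pair_checks: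
  "run (pair_checks C ps) f \<longleftrightarrow> (\<forall>(u, v)\<in>set ps. C u v (f u) (f v))"
  by (induction ps) auto

lemma length_queries_pair_checks: "length (queries (pair_checks C ps) f) \<le> 2 * length ps"
  by (induction ps) auto

lemma set_queries_pair_checks:
  "set (queries (pair_checks C ps) f) \<subseteq> fst ` set ps \<union> snd ` set ps"
  by (induction ps) auto

lemma prob_pair_pmf_Times:
  "measure_pmf.prob (pair_pmf M N) (A \<times> B) = measure_pmf.prob M A * measure_pmf.prob N B"
proof -
  \<comment> \<open>Cutting down to the supports makes both factors countable.\<close>
  have "measure_pmf.prob (pair_pmf M N) (A \<times> B) =
      measure_pmf.prob (pair_pmf M N) ((A \<inter> set_pmf M) \<times> (B \<inter> set_pmf N))"
    using measure_Int_set_pmf[of "pair_pmf M N" "A \<times> B"] by (simp add: Times_Int_Times)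
  also have "\<dots> = measure_pmf.prob M A * measure_pmf.prob N B"
    by (simp add: measure_pmf_prob_product measure_Int_set_pmf)
  finally show ?thesis .
qed

lemma prob_replicate_pmf_all:
  "measure_pmf.prob (replicate_pmf k p) {xs. \<forall>x\<in>set xs. P x} = measure_pmf.prob p {x. P x} ^ k"
proof (induction k)
  case (Suc k)
  have "replicate_pmf (Suc k) p = map_pmf (\<lambda>(x, xs). x # xs) (pair_pmf p (replicate_pmf k p))"
    by (simp add: pair_pmf_def map_bind_pmf)
  then have "measure_pmf.prob (replicate_pmf (Suc k) p) {xs. \<forall>x\<in>set xs. P x} =
      measure_pmf.prob (pair_pmf p (replicate_pmf k p)) ({x. P x} \<times> {xs. \<forall>x\<in>set xs. P x})"
    by (simp add: vimage_def case_prod_unfold)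
      (rule arg_cong[where f = "measure_pmf.prob _"], auto)
  also have "\<dots> = measure_pmf.prob p {x. P x} * measure_pmf.prob (replicate_pmf k p) {xs. \<forall>x\<in>set xs. P x}"
    by (rule prob_pair_pmf_Times)
  finally show ?case using Suc by simp
qed simp

text \<open>By Bernoulli, \<open>(1 + x) ^ k\<close> is at least 3, while
  \<open>(1 - x) ^ k * (1 + x) ^ k\<close> is at most 1.\<close>

lemma power_one_minus_le_third:
  fixes x :: real
  assumes "0 \<le> x" "x \<le> 1" "2 \<le> real k * x"
  shows "(1 - x) ^ k \<le> 1 / 3"
proof -
  have "(1 - x) ^ k * 3 \<le> (1 - x) ^ k * (1 + real k * x)"
    using assms by (intro mult_left_mono) auto
  also have "\<dots> \<le> (1 - x) ^ k * (1 + x) ^ k"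
    using assms Bernoulli_inequality[of x k] by (intro mult_left_mono) auto
  also have "\<dots> = (1 - x\<^sup>2) ^ k"
    by (simp add: power_mult_distrib[symmetric] algebra_simps power2_eq_square)
  also have "\<dots> \<le> 1" using assms by (intro power_le_one) (auto simp: power_le_one abs_square_le_1)
  finally show ?thesis by simp
qed

text \<open>Whether a list-homomorphism exists is known without queries; if none does, every map is
  infinitely far and rejection is correct.\<close>

definition component_tester :: "'h ugraph \<Rightarrow> ('v, 'h) tester" where
  "component_tester H \<epsilon> G L w = (if \<exists>g. list_hom H G L g
     then map_pmf (pair_checks (extendable H G L))
       (replicate_pmf (nat \<lceil>2 / \<epsilon>\<rceil>) (component_pair_pmf G w))
     else return_pmf (Output False))"

lemma component_pair_rejection_prob:
  assumes H: "rectangular H" and inst: "lhom_instance H G L w" and ex: "list_hom H G L g0"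
    and far: "far_from_hom H G L w \<epsilon> f"
  shows "\<epsilon> \<le> 1 - measure_pmf.prob (component_pair_pmf G w) {(u, v). extendable H G L u v (f u) (f v)}"
proof -
  have G: "finite_ugraph G" using inst unfolding lhom_instance_def by blast
  have finV: "finite (verts G)" using G unfolding finite_ugraph_def by blast
  have fin: "finite (component G u)" for u using finV unfolding component_def by auto
  let ?A = "SIGMA u:verts G. component G u"
  let ?R = "{(u, v). \<not> extendable H G L u v (f u) (f v)}"
  have finA: "finite ?A" using finV fin by blast
  have "\<epsilon> \<le> (\<Sum>u\<in>verts G. \<Sum>v\<in>component G u. w u * w v / component_weight G w u *
            of_bool (\<not> extendable H G L u v (f u) (f v)))"
    by (rule pivot_rejections_ge_distance[OF assms])
  also have "\<dots> = (\<Sum>(u, v)\<in>?A. w u * w v / component_weight G w u *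
            of_bool (\<not> extendable H G L u v (f u) (f v)))"
    using finV fin by (subst sum.Sigma) auto
  also have "\<dots> = (\<Sum>x\<in>?A. if x \<in> ?R then pmf (component_pair_pmf G w) x else 0)"
    by (rule sum.cong) (auto simp: pmf_component_pair[OF inst])
  also have "\<dots> = (\<Sum>x\<in>?A \<inter> ?R. pmf (component_pair_pmf G w) x)"
    using finA by (simp add: sum.inter_restrict)
  also have "\<dots> = measure_pmf.prob (component_pair_pmf G w) (?A \<inter> ?R)"
    using finA by (simp add: measure_measure_pmf_finite)
  also have "\<dots> \<le> measure_pmf.prob (component_pair_pmf G w) (UNIV - {(u, v). extendable H G L u v (f u) (f v)})"
    by (rule measure_pmf.finite_measure_mono) auto
  also have "\<dots> = 1 - measure_pmf.prob (component_pair_pmf G w) {(u, v). extendable H G L u v (f u) (f v)}"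
    using measure_pmf.prob_compl[of "{(u, v). extendable H G L u v (f u) (f v)}" "component_pair_pmf G w"] by simp
  finally show ?thesis .
qed

lemma component_tester_rejects:
  assumes H: "rectangular H" and \<epsilon>: "0 < \<epsilon>" and inst: "lhom_instance H G L w"
    and far: "far_from_hom H G L w \<epsilon> f"
  shows "2 / 3 \<le> measure_pmf.prob (component_tester H \<epsilon> G L w) {A. \<not> run A f}"
proof (cases "\<exists>g. list_hom H G L g")
  case True
  then obtain g0 where g0: "list_hom H G L g0" by blast
  let ?k = "nat \<lceil>2 / \<epsilon>\<rceil>" and ?D = "component_pair_pmf G w"
  define p where "p = measure_pmf.prob ?D {(u, v). extendable H G L u v (f u) (f v)}"
  have p: "0 \<le> p" "\<epsilon> \<le> 1 - p"
    using component_pair_rejection_prob[OF H inst g0 far] unfolding p_def by simp_all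
  have "2 / \<epsilon> \<le> real ?k" by (rule real_nat_ceiling_ge)
  then have "2 \<le> real ?k * \<epsilon>" using \<epsilon> by (simp only: pos_divide_le_eq)
  also have "\<dots> \<le> real ?k * (1 - p)" using p by (intro mult_left_mono) auto
  finally have "(1 - (1 - p)) ^ ?k \<le> 1 / 3"
    using p \<epsilon> by (intro power_one_minus_le_third) auto
  then have pk: "p ^ ?k \<le> 1 / 3" by simp
  let ?M = "replicate_pmf ?k ?D"
  have "measure_pmf.prob (component_tester H \<epsilon> G L w) {A. \<not> run A f} =
      measure_pmf.prob ?M (UNIV - {xs. \<forall>x\<in>set xs. case x of (u, v) \<Rightarrow> extendable H G L u v (f u) (f v)})"
    using True unfolding component_tester_def
    by (auto simp: vimage_def run_pair_checks intro!: arg_cong[where f = "measure_pmf.prob _"])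
  also have "\<dots> = 1 - p ^ ?k"
    using measure_pmf.prob_compl[of "{xs. \<forall>x\<in>set xs. case x of (u, v) \<Rightarrow> extendable H G L u v (f u) (f v)}" ?M]
    unfolding p_def by (simp add: prob_replicate_pmf_all)
  finally show ?thesis using pk by simp
qed (simp add: component_tester_def)

lemma lhom_tester_component_tester:
  assumes H: "rectangular H"
  shows "lhom_tester H (component_tester H :: ('v, 'h) tester)"
  unfolding lhom_tester_def
proof (intro allI impI conjI)
  fix \<epsilon> and G :: "'v ugraph" and L :: "'v \<Rightarrow> 'h set" and w f
  assume \<epsilon>: "(0::real) < \<epsilon>" and inst: "lhom_instance H G L w" and f: "f \<in> verts G \<rightarrow> verts H"
  have D: "set_pmf (component_pair_pmf G w) \<subseteq> verts G \<times> verts G"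
    unfolding set_pmf_eq pmf_component_pair[OF inst] by (auto simp: component_def split: if_splits)
  show "\<forall>A\<in>set_pmf (component_tester H \<epsilon> G L w). set (queries A f) \<subseteq> verts G"
  proof
    fix A assume A: "A \<in> set_pmf (component_tester H \<epsilon> G L w)"
    show "set (queries A f) \<subseteq> verts G"
    proof (cases "\<exists>g. list_hom H G L g")
      case True
      then obtain ps where "set ps \<subseteq> verts G \<times> verts G" "A = pair_checks (extendable H G L) ps"
        using A D unfolding component_tester_def by (auto simp: set_replicate_pmf in_lists_conv_set)
      then show ?thesis using set_queries_pair_checks[of "extendable H G L" ps f] by fastforce
    next
      case False
      then have "A = Output False" using A unfolding component_tester_def by (simp add: if_not_P)
      then show ?thesis by simp
    qed
  qed
  show "2 / 3 \<le> measure_pmf.prob (component_tester H \<epsilon> G L w) {A. run A f}" if "list_hom H G L f"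
  proof -
    \<comment> \<open>The error is one-sided: \<open>f\<close> itself witnesses that every pair is
      extendable.\<close>
    have "{A. run A f} \<supseteq> set_pmf (component_tester H \<epsilon> G L w)"
      using that unfolding component_tester_def by (auto simp: run_pair_checks extendable_def)
    then have "measure_pmf.prob (component_tester H \<epsilon> G L w) {A. run A f} = 1"
      using measure_pmf.prob_eq_1 by (auto simp: AE_measure_pmf_iff)
    then show ?thesis by simp
  qed
  show "2 / 3 \<le> measure_pmf.prob (component_tester H \<epsilon> G L w) {A. \<not> run A f}"
    if "far_from_hom H G L w \<epsilon> f"
    by (rule component_tester_rejects[OF H \<epsilon> inst that])
qed

lemma query_bound_component_tester:
  "query_bound H (component_tester H) (\<lambda>\<epsilon>. 2 * nat \<lceil>2 / \<epsilon>\<rceil>)"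
proof -
  have "length (queries A f) \<le> 2 * nat \<lceil>2 / \<epsilon>\<rceil>" if A: "A \<in> set_pmf (component_tester H \<epsilon> G L w)" for A f \<epsilon> G L w
  proof (cases "\<exists>g. list_hom H G L g")
    case True
    then obtain ps where "length ps = nat \<lceil>2 / \<epsilon>\<rceil>" "A = pair_checks (extendable H G L) ps"
      using A unfolding component_tester_def by (auto simp: set_replicate_pmf)
    then show ?thesis using length_queries_pair_checks[of "extendable H G L" ps f] by simp
  next
    case False
    then have "A = Output False" using A unfolding component_tester_def by (simp add: if_not_P)
    then show ?thesis by simp
  qed
  then show ?thesis unfolding query_bound_def by blast
qed

lemma rectangular_imp_testable: "rectangular H \<Longrightarrow> constant_query_testable H"
  unfolding constant_query_testable_def
  using lhom_tester_component_tester query_bound_component_tester by blast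

section \<open>Non-rectangular graphs are not testable with constantly many queries\<close>

lemma run_queries_cong:
  "(\<And>v. v \<in> set (queries A f) \<Longrightarrow> f v = g v) \<Longrightarrow> run A f = run A g"
proof (induction A)
  case (Query v k)
  have v: "f v = g v" using Query.prems[of v] by simp
  have "run (k (f v)) f = run (k (f v)) g"
  proof (rule Query.IH)
    show "f u = g u" if "u \<in> set (queries (k (f v)) f)" for u
      by (rule Query.prems) (simp add: that)
  qed simp
  then show ?case by (simp add: v)
qed simp

text \<open>An adaptive algorithm that sees at most two possible answers per query is a binary decision tree.\<close>

lemma card_Union_queries:
  assumes "\<And>f v. f \<in> F \<Longrightarrow> f v \<in> {\<alpha> v, \<beta> v}" and "\<And>f. f \<in> F \<Longrightarrow> length (queries A f) \<le> k"
  shows "finite (\<Union>f\<in>F. set (queries A f)) \<and> card (\<Union>f\<in>F. set (queries A f)) < 2 ^ k"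
  using assms
proof (induction A arbitrary: F k)
  case (Query v K)
  show ?case
  proof (cases "F = {}")
    case False
    then obtain k' where k: "k = Suc k'" using Query.prems(2) by (cases k) fastforce+
    \<comment> \<open>The queries made below the root when the answer at \<open>v\<close> is
      \<open>h\<close>.\<close>
    define U where "U h = (\<Union>f\<in>{f \<in> F. f v = h}. set (queries (K h) f))" for h
    have U: "finite (U h) \<and> card (U h) < 2 ^ k'" for h
      unfolding U_def
    proof (rule Query.IH)
      show "length (queries (K h) f) \<le> k'" if "f \<in> {f \<in> F. f v = h}" for f
        using that Query.prems(2)[of f] k by auto
    qed (use Query.prems(1) in auto)
    have eq: "(\<Union>f\<in>F. set (queries (Query v K) f)) \<subseteq> insert v (U (\<alpha> v) \<union> U (\<beta> v))"
      using Query.prems(1)[of _ v] unfolding U_def by fastforce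
    have fin: "finite (insert v (U (\<alpha> v) \<union> U (\<beta> v)))" using U by simp
    \<comment> \<open>The root and two subtrees give at most
      \<open>1 + 2 * (2 ^ k' - 1) = 2 ^ k - 1\<close> vertices.\<close>
    have "card (insert v (U (\<alpha> v) \<union> U (\<beta> v))) \<le> Suc (card (U (\<alpha> v)) + card (U (\<beta> v)))"
      using card_Un_le[of "U (\<alpha> v)" "U (\<beta> v)"] fin by (simp add: card_insert_if)
    also have "\<dots> < 2 ^ k" using U[of "\<alpha> v"] U[of "\<beta> v"] k by auto
    finally show ?thesis
      using card_mono[OF fin eq] finite_subset[OF eq fin] by simp
  qed simp
qed simp

text \<open>Carries a bound for each deterministic algorithm over to a randomized one by taking
  expectations.\<close>

lemma sum_prob_le_of_pointwise:
  assumes "finite J"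
    and le: "\<And>A. A \<in> set_pmf M \<Longrightarrow>
      (\<Sum>j\<in>J. of_bool (P j A)) \<le> (\<Sum>j\<in>J. of_bool (Q j A)) + (c::real)"
  shows "(\<Sum>j\<in>J. measure_pmf.prob M {A. P j A}) \<le> (\<Sum>j\<in>J. measure_pmf.prob M {A. Q j A}) + c"
proof -
  have int: "integrable (measure_pmf M) (\<lambda>A. of_bool (R j A) :: real)" for R :: "'a \<Rightarrow> 'b \<Rightarrow> bool" and j
    by (rule measure_pmf.integrable_const_bound[where B = 1]) auto
  have prob: "(\<Sum>j\<in>J. measure_pmf.prob M {A. R j A}) =
      measure_pmf.expectation M (\<lambda>A. \<Sum>j\<in>J. of_bool (R j A))" for R :: "'a \<Rightarrow> 'b \<Rightarrow> bool"
  proof -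
    have "measure_pmf.prob M {A. R j A} = measure_pmf.expectation M (\<lambda>A. of_bool (R j A))" for j
    proof -
      have "(\<lambda>A. of_bool (R j A)) = (indicator {A. R j A} :: _ \<Rightarrow> real)" by (auto simp: indicator_def)
      then show ?thesis by simp
    qed
    then show ?thesis using int by (simp add: Bochner_Integration.integral_sum)
  qed
  have "measure_pmf.expectation M (\<lambda>A. \<Sum>j\<in>J. of_bool (P j A) :: real)
      \<le> measure_pmf.expectation M (\<lambda>A. (\<Sum>j\<in>J. of_bool (Q j A)) + c)"
    by (rule integral_mono_AE) (auto simp: AE_measure_pmf_iff le intro!: int)
  also have "\<dots> = measure_pmf.expectation M (\<lambda>A. \<Sum>j\<in>J. of_bool (Q j A)) + c"
    by (subst Bochner_Integration.integral_add) (auto intro!: int)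
  finally show ?thesis unfolding prob .
qed

section \<open>Random subsets are rarely small\<close>

text \<open>This is the variance of a sum of \<open>card S\<close> independent signs. In the
  induction, \<open>R\<close> and \<open>insert x R\<close> contribute
  \<open>(t - 1)^2 + (t + 1)^2 = 2 * t^2 + 2\<close>, where \<open>t\<close> is the old
  deviation.\<close>

lemma sum_Pow_deviation_squared:
  assumes "finite S"
  shows "(\<Sum>R\<in>Pow S. (2 * real (card R) - real (card S))\<^sup>2) = real (card S) * 2 ^ card S"
  using assms
proof (induction S rule: finite_induct)
  case (insert x S)
  let ?n = "real (card S)"
  have inj: "inj_on (insert x) (Pow S)" using insert.hyps by (auto simp: inj_on_def)
  have disj: "Pow S \<inter> insert x ` Pow S = {}" using insert.hyps by auto
  have "(\<Sum>R\<in>Pow (insert x S). (2 * real (card R) - real (card (insert x S)))\<^sup>2) =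
      (\<Sum>R\<in>Pow S. (2 * real (card R) - (?n + 1))\<^sup>2) +
      (\<Sum>R\<in>Pow S. (2 * real (card (insert x R)) - (?n + 1))\<^sup>2)"
    using insert.hyps disj inj by (simp add: Pow_insert sum.union_disjoint sum.reindex add.commute)
  also have "(\<Sum>R\<in>Pow S. (2 * real (card (insert x R)) - (?n + 1))\<^sup>2) =
      (\<Sum>R\<in>Pow S. (2 * (real (card R) + 1) - (?n + 1))\<^sup>2)"
  proof (rule sum.cong[OF refl])
    fix R assume "R \<in> Pow S"
    then have "finite R" "x \<notin> R" using insert.hyps finite_subset by auto
    then show "(2 * real (card (insert x R)) - (?n + 1))\<^sup>2 = (2 * (real (card R) + 1) - (?n + 1))\<^sup>2"
      by simp
  qed
  also have "(\<Sum>R\<in>Pow S. (2 * real (card R) - (?n + 1))\<^sup>2) + \<dots> =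
      (\<Sum>R\<in>Pow S. 2 * (2 * real (card R) - ?n)\<^sup>2 + 2)"
    by (subst sum.distrib[symmetric], rule sum.cong[OF refl]) (simp add: power2_eq_square algebra_simps)
  also have "\<dots> = 2 * (?n * 2 ^ card S) + 2 * 2 ^ card S"
    using insert by (simp add: sum.distrib sum_distrib_left[symmetric] card_Pow)
  finally show ?case using insert.hyps by (simp add: algebra_simps)
qed simp

text \<open>Chebyshev's inequality: for these sets the deviation exceeds half of
  \<open>card S\<close>.\<close>

lemma card_small_subsets_le:
  assumes S: "finite S" "S \<noteq> {}"
  shows "real (card {R \<in> Pow S. 4 * card R < card S}) \<le> 4 / real (card S) * 2 ^ card S"
proof -
  let ?n = "real (card S)" and ?B = "{R \<in> Pow S. 4 * card R < card S}"
  have n: "?n > 0" using S by (simp add: card_gt_0_iff)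
  have "real (card ?B) * (?n / 2)\<^sup>2 = (\<Sum>R\<in>?B. (?n / 2)\<^sup>2)" by simp
  also have "\<dots> \<le> (\<Sum>R\<in>?B. (2 * real (card R) - ?n)\<^sup>2)"
  proof (rule sum_mono)
    fix R assume "R \<in> ?B"
    then have "?n / 2 \<le> ?n - 2 * real (card R)" by auto
    then have "(?n / 2)\<^sup>2 \<le> (?n - 2 * real (card R))\<^sup>2" by (rule power_mono) simp
    then show "(?n / 2)\<^sup>2 \<le> (2 * real (card R) - ?n)\<^sup>2" by (simp add: power2_commute)
  qed
  also have "\<dots> \<le> (\<Sum>R\<in>Pow S. (2 * real (card R) - ?n)\<^sup>2)"
    using S by (intro sum_mono2) auto
  also have "\<dots> = ?n * 2 ^ card S" by (rule sum_Pow_deviation_squared[OF S(1)])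
  finally show ?thesis using n by (simp add: field_simps power2_eq_square)
qed

section \<open>The doubled cube and its satisfied and violated maps\<close>

text \<open>Vertices are natural numbers: parity tells the side, and halving recovers the code of
  the set.\<close>

definition left_vertex :: "nat set \<Rightarrow> nat" where
  "left_vertex S = 2 * set_encode S"

definition right_vertex :: "nat set \<Rightarrow> nat" where
  "right_vertex S = 2 * set_encode S + 1"

text \<open>The Hasse diagram of the Boolean lattice, doubled to a bipartite graph. The edges of each
  direction \<open>i\<close> form an induced matching that covers half of the vertices.\<close>

definition cube_graph :: "nat \<Rightarrow> nat ugraph" where
  "cube_graph s = (let E = {(left_vertex S, right_vertex (insert i S)) | S i. S \<subseteq> {..<s} \<and> i < s \<and> i \<notin> S}
     in \<lparr>verts = left_vertex ` Pow {..<s} \<union> right_vertex ` Pow {..<s}, edges = E \<union> E\<inverse>\<rparr>)"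

text \<open>On an edge the lists leave the pairs \<open>(a, b)\<close>, \<open>(c, b)\<close>,
  \<open>(c, d)\<close> for a walk \<open>a - b - c - d\<close> without the chord
  \<open>a - d\<close>; so \<open>a\<close> on the left forces \<open>b\<close> on the
  right.\<close>

definition cube_lists :: "'h \<Rightarrow> 'h \<Rightarrow> 'h \<Rightarrow> 'h \<Rightarrow> nat \<Rightarrow> 'h set" where
  "cube_lists a b c d v = (if even v then {a, c} else {b, d})"

definition cube_weight :: "nat \<Rightarrow> nat \<Rightarrow> real" where
  "cube_weight s v = 1 / 2 ^ (s + 1)"

text \<open>On the edge of direction \<open>i\<close> above \<open>S\<close>, the values are \<open>a\<close> or \<open>c\<close> depending on \<open>S \<in> P\<close>, and
  \<open>d\<close> or \<open>b\<close> depending on \<open>S \<in> Q\<close>; the edge is violated iff \<open>S \<in> P \<inter> Q\<close>. All other edges are satisfied.\<close>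

definition cube_map ::
  "'h \<Rightarrow> 'h \<Rightarrow> 'h \<Rightarrow> 'h \<Rightarrow> nat \<Rightarrow> nat set set \<Rightarrow> nat set set \<Rightarrow> nat \<Rightarrow> 'h" where
  "cube_map a b c d i P Q v = (let S = set_decode (v div 2) in
     if even v then (if S \<in> P then a else c)
     else (if i \<in> S \<and> S - {i} \<in> Q then d else b))"

lemma cube_map_left: "finite S \<Longrightarrow> cube_map a b c d i P Q (left_vertex S) = (if S \<in> P then a else c)"
  unfolding cube_map_def left_vertex_def by simp

lemma cube_map_right:
  "finite S \<Longrightarrow> cube_map a b c d i P Q (right_vertex S) = (if i \<in> S \<and> S - {i} \<in> Q then d else b)"
  unfolding cube_map_def right_vertex_def by simp

lemma left_vertex_eq_iff: "finite S \<Longrightarrow> finite T \<Longrightarrow> left_vertex S = left_vertex T \<longleftrightarrow> S = T"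
  unfolding left_vertex_def by (simp add: set_encode_eq)

lemma right_vertex_eq_iff: "finite S \<Longrightarrow> finite T \<Longrightarrow> right_vertex S = right_vertex T \<longleftrightarrow> S = T"
  unfolding right_vertex_def by (simp add: set_encode_eq)

lemma left_neq_right: "left_vertex S \<noteq> right_vertex T"
  unfolding left_vertex_def right_vertex_def by presburger

lemma verts_cube_graph: "verts (cube_graph s) = left_vertex ` Pow {..<s} \<union> right_vertex ` Pow {..<s}"
  unfolding cube_graph_def Let_def by simp

lemma cube_graph_edgeE:
  assumes "(u, v) \<in> edges (cube_graph s)"
  obtains S i where "S \<subseteq> {..<s}" "i < s" "i \<notin> S" "u = left_vertex S" "v = right_vertex (insert i S)"
  | S i where "S \<subseteq> {..<s}" "i < s" "i \<notin> S" "v = left_vertex S" "u = right_vertex (insert i S)"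
  using assms unfolding cube_graph_def Let_def by auto

lemma cube_graph_edgeI:
  "S \<subseteq> {..<s} \<Longrightarrow> i < s \<Longrightarrow> i \<notin> S \<Longrightarrow> (left_vertex S, right_vertex (insert i S)) \<in> edges (cube_graph s)"
  unfolding cube_graph_def Let_def by auto

lemma finite_cube_graph: "finite_ugraph (cube_graph s)"
  unfolding finite_ugraph_def
proof (intro conjI)
  show "edges (cube_graph s) \<subseteq> verts (cube_graph s) \<times> verts (cube_graph s)"
    by (auto simp: verts_cube_graph elim!: cube_graph_edgeE)
  show "sym (edges (cube_graph s))" unfolding cube_graph_def Let_def by (auto simp: sym_def)
qed (simp add: verts_cube_graph)

lemma card_verts_cube_graph: "card (verts (cube_graph s)) = 2 ^ (s + 1)"
proof -
  have fin: "S \<in> Pow {..<s} \<Longrightarrow> finite S" for S using finite_subset[of S "{..<s}"] by auto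
  have "inj_on left_vertex (Pow {..<s})" "inj_on right_vertex (Pow {..<s})"
    using left_vertex_eq_iff right_vertex_eq_iff fin by (meson inj_onI)+
  then show ?thesis unfolding verts_cube_graph
    by (subst card_Un_disjoint) (auto simp: card_image card_Pow left_neq_right left_neq_right[symmetric])
qed

lemma lhom_instance_cube_graph:
  assumes "{a, b, c, d} \<subseteq> verts H"
  shows "lhom_instance H (cube_graph s) (cube_lists a b c d) (cube_weight s)"
  unfolding lhom_instance_def cube_weight_def cube_lists_def
  using assms finite_cube_graph card_verts_cube_graph[of s] by auto

lemma cube_map_in: "cube_map a b c d i P Q v \<in> cube_lists a b c d v"
  unfolding cube_map_def cube_lists_def Let_def by auto

lemma cube_map_in_verts:
  assumes "{a, b, c, d} \<subseteq> verts H"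
  shows "cube_map a b c d i P Q v \<in> verts H"
  using assms cube_map_in[of a b c d i P Q v] unfolding cube_lists_def by (auto split: if_splits)

text \<open>Edges of direction \<open>i\<close> carry \<open>(a, b)\<close> or
  \<open>(c, d)\<close>. On any other edge, either the upper set avoids \<open>i\<close> and the
  right end has value \<open>b\<close>, or the lower set contains \<open>i\<close>, is not in
  \<open>P\<close>, and the left end has value \<open>c\<close>, which is compatible with both
  \<open>b\<close> and \<open>d\<close>.\<close>

lemma list_hom_cube_map:
  assumes H: "finite_ugraph H" and e: "(a, b) \<in> edges H" "(b, c) \<in> edges H" "(c, d) \<in> edges H"
    and P: "P \<subseteq> Pow ({..<s} - {i})"
  shows "list_hom H (cube_graph s) (cube_lists a b c d) (cube_map a b c d i P (- P))"
proof -
  have sym: "(x, y) \<in> edges H \<Longrightarrow> (y, x) \<in> edges H" for x y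
    using H unfolding finite_ugraph_def by (meson symD)
  let ?f = "cube_map a b c d i P (- P)"
  have "(?f (left_vertex S), ?f (right_vertex (insert j S))) \<in> edges H"
    if "S \<subseteq> {..<s}" "j < s" "j \<notin> S" for S j
  proof -
    have "finite S" using that(1) finite_subset by blast
    have "S \<notin> P" if "i \<in> S" using that P by auto
    with \<open>finite S\<close> \<open>j \<notin> S\<close> show ?thesis using e sym[OF e(2)]
      by (cases "i = j"; cases "i \<in> S"; cases "S \<in> P") (simp_all add: cube_map_left cube_map_right)
  qed
  moreover have "{a, b, c, d} \<subseteq> verts H" using H e unfolding finite_ugraph_def by blast
  ultimately show ?thesis unfolding list_hom_def
    using sym by (auto intro: cube_map_in cube_map_in_verts elim!: cube_graph_edgeE)
qed

text \<open>Each \<open>S\<close> in \<open>P\<close> gives a violated edge with values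
  \<open>a\<close> and \<open>d\<close>. These edges are disjoint, and a list-homomorphism must
  change an end of each, which costs at least \<open>card P / 2 ^ (s + 1)\<close>.\<close>

lemma far_cube_map:
  assumes ad: "(a, d) \<notin> edges H" and i: "i < s" and P: "P \<subseteq> Pow ({..<s} - {i})"
    and card: "2 ^ s \<le> 8 * card P"
  shows "far_from_hom H (cube_graph s) (cube_lists a b c d) (cube_weight s) (1 / 16)
           (cube_map a b c d i P P)"
  unfolding far_from_hom_def dist_to_hom_def
proof (rule INF_greatest)
  let ?f = "cube_map a b c d i P P"
  fix g assume "g \<in> {g. list_hom H (cube_graph s) (cube_lists a b c d) g}"
  then have g: "(g u, g v) \<in> edges H" if "(u, v) \<in> edges (cube_graph s)" for u v
    using that unfolding list_hom_def by blast
  let ?D = "{v \<in> verts (cube_graph s). ?f v \<noteq> g v}"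
  \<comment> \<open>An end of the matching edge above \<open>S\<close> at which \<open>g\<close>
    differs from the map.\<close>
  define \<phi> where "\<phi> S = (if ?f (left_vertex S) \<noteq> g (left_vertex S)
    then left_vertex S else right_vertex (insert i S))" for S
  have finS: "finite S" and S: "S \<subseteq> {..<s}" "i \<notin> S" if "S \<in> P" for S
    using that P finite_subset[of S "{..<s}"] by auto
  have "\<phi> ` P \<subseteq> ?D"
  proof
    fix v assume "v \<in> \<phi> ` P"
    then obtain S where SP: "S \<in> P" and v: "v = \<phi> S" by blast
    have "(g (left_vertex S), g (right_vertex (insert i S))) \<in> edges H"
      using g cube_graph_edgeI S[OF SP] i by blast
    moreover have "?f (left_vertex S) = a" "?f (right_vertex (insert i S)) = d"
      using SP S[OF SP] finS[OF SP] by (simp_all add: cube_map_left cube_map_right)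
    ultimately have "?f v \<noteq> g v" using ad unfolding v \<phi>_def by auto
    moreover have "v \<in> verts (cube_graph s)"
      using S[OF SP] i unfolding v \<phi>_def verts_cube_graph by auto
    ultimately show "v \<in> ?D" by blast
  qed
  moreover have "inj_on \<phi> P"
  proof (rule inj_onI)
    fix S T assume "S \<in> P" "T \<in> P" and eq: "\<phi> S = \<phi> T"
    then have "finite S" "finite T" "i \<notin> S" "i \<notin> T" using finS S by auto
    with eq show "S = T" unfolding \<phi>_def
      by (auto simp: left_vertex_eq_iff right_vertex_eq_iff left_neq_right left_neq_right[symmetric]
          insert_ident split: if_split_asm)
  qed
  moreover have "finite ?D" using finite_cube_graph[of s] unfolding finite_ugraph_def by simp
  ultimately have "card P \<le> card ?D" by (blast intro: card_inj_on_le)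
  with card have "2 ^ s \<le> 8 * card ?D" by linarith
  then have "real (2 ^ s) \<le> real (8 * card ?D)" by (simp only: of_nat_le_iff)
  then have "1 / 16 \<le> map_dist (cube_graph s) (cube_weight s) ?f g"
    unfolding map_dist_def cube_weight_def by (simp add: field_simps)
  then show "ereal (1 / 16) \<le> ereal (map_dist (cube_graph s) (cube_weight s) ?f g)" by simp
qed

section \<open>Indistinguishability along directions that are not exposed\<close>

definition exposed_directions :: "nat \<Rightarrow> nat set \<Rightarrow> nat set" where
  "exposed_directions s U = {i. i < s \<and> (\<exists>S \<subseteq> {..<s} - {i}. left_vertex S \<in> U \<and> right_vertex (insert i S) \<in> U)}"

text \<open>An edge determines its direction, as the difference of the sets at its two ends.\<close>

lemma card_exposed_directions:
  assumes "finite U"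
  shows "card (exposed_directions s U) \<le> card U * card U"
proof -
  let ?g = "\<lambda>(u, v). the_elem (set_decode (v div 2) - set_decode (u div 2))"
  have "exposed_directions s U \<subseteq> ?g ` (U \<times> U)"
  proof
    fix i assume "i \<in> exposed_directions s U"
    then obtain S where S: "S \<subseteq> {..<s} - {i}" "left_vertex S \<in> U" "right_vertex (insert i S) \<in> U"
      unfolding exposed_directions_def by blast
    have "finite S" using S(1) finite_subset by blast
    then have "set_decode (right_vertex (insert i S) div 2) - set_decode (left_vertex S div 2) = {i}"
      using S(1) unfolding left_vertex_def right_vertex_def
      by (simp del: set_encode_insert) auto
    then have "i = ?g (left_vertex S, right_vertex (insert i S))" by simp
    then show "i \<in> ?g ` (U \<times> U)" using S by blast
  qed
  then have "card (exposed_directions s U) \<le> card (U \<times> U)"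
    using assms by (intro surj_card_le) auto
  then show ?thesis by (simp add: card_cartesian_product)
qed

text \<open>Without an exposed edge, toggling \<open>P\<close> at the queried right ends turns the answers for the
  list-homomorphism into those for the violating map.\<close>

lemma card_accepting_eq:
  assumes i: "i < s" "i \<notin> exposed_directions s U" and U: "U \<subseteq> verts (cube_graph s)"
    and q: "\<And>P Q. set (queries A (cube_map a b c d i P Q)) \<subseteq> U"
  shows "card {P \<in> Pow (Pow ({..<s} - {i})). run A (cube_map a b c d i P (- P))} =
         card {P \<in> Pow (Pow ({..<s} - {i})). run A (cube_map a b c d i P P)}"
proof -
  define Z where "Z = {S. S \<subseteq> {..<s} - {i} \<and> right_vertex (insert i S) \<in> U}"
  define \<tau> where "\<tau> P = (P - Z) \<union> (Z - P)" for P
  have \<tau>: "\<tau> (\<tau> P) = P" for P unfolding \<tau>_def by blast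
  have Z: "Z \<subseteq> Pow ({..<s} - {i})" unfolding Z_def by blast
  have \<tau>_in: "\<tau> P \<in> Pow (Pow ({..<s} - {i}))" if "P \<in> Pow (Pow ({..<s} - {i}))" for P
    using that Z unfolding \<tau>_def by blast
  have same: "run A (cube_map a b c d i P (- P)) = run A (cube_map a b c d i (\<tau> P) (\<tau> P))" for P
  proof (rule run_queries_cong)
    fix v assume "v \<in> set (queries A (cube_map a b c d i P (- P)))"
    then have vU: "v \<in> U" using q by blast
    then consider S where "S \<subseteq> {..<s}" "v = left_vertex S" | S where "S \<subseteq> {..<s}" "v = right_vertex S"
      using U unfolding verts_cube_graph by blast
    then show "cube_map a b c d i P (- P) v = cube_map a b c d i (\<tau> P) (\<tau> P) v"
    proof cases
      case 1
      then have "finite S" using finite_subset by blast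
      \<comment> \<open>Otherwise both ends of the edge above \<open>S\<close> would lie in
        \<open>U\<close>, and \<open>i\<close> would be exposed.\<close>
      moreover have "S \<notin> Z" using i 1 vU unfolding Z_def exposed_directions_def by blast
      ultimately show ?thesis using 1 by (simp add: cube_map_left \<tau>_def)
    next
      case 2
      then have "finite S" using finite_subset by blast
      \<comment> \<open>At a queried right end membership is toggled, which matches the complement
        in the satisfied map.\<close>
      moreover have "S - {i} \<in> Z" if "i \<in> S" using 2 vU that unfolding Z_def by (auto simp: insert_absorb)
      ultimately show ?thesis using 2 by (auto simp: cube_map_right \<tau>_def)
    qed
  qed
  have "bij_betw \<tau> {P \<in> Pow (Pow ({..<s} - {i})). run A (cube_map a b c d i P (- P))}
      {P \<in> Pow (Pow ({..<s} - {i})). run A (cube_map a b c d i P P)}"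
  proof (rule bij_betw_byWitness[where f' = \<tau>])
    show "\<tau> ` {P \<in> Pow (Pow ({..<s} - {i})). run A (cube_map a b c d i P (- P))}
        \<subseteq> {P \<in> Pow (Pow ({..<s} - {i})). run A (cube_map a b c d i P P)}"
      unfolding same using \<tau>_in by blast
    show "\<tau> ` {P \<in> Pow (Pow ({..<s} - {i})). run A (cube_map a b c d i P P)}
        \<subseteq> {P \<in> Pow (Pow ({..<s} - {i})). run A (cube_map a b c d i P (- P))}"
    proof (rule image_subsetI)
      fix P assume "P \<in> {P \<in> Pow (Pow ({..<s} - {i})). run A (cube_map a b c d i P P)}"
      then show "\<tau> P \<in> {P \<in> Pow (Pow ({..<s} - {i})). run A (cube_map a b c d i P (- P))}"
        using \<tau>_in[of P] same[of "\<tau> P"] unfolding \<tau> by blast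
    qed
  qed (simp_all add: \<tau>)
  then show ?thesis by (rule bij_betw_same_card)
qed

lemma sum_of_bool_directions:
  fixes s :: nat
  shows "(\<Sum>(i, P)\<in>(SIGMA i:{..<s}. Pow (Pow ({..<s} - {i}))). of_bool (X i P) :: real) =
    (\<Sum>i<s. real (card {P \<in> Pow (Pow ({..<s} - {i})). X i P}))"
  by (subst sum.Sigma[symmetric]) (simp_all add: Int_def)

text \<open>Directions that are not exposed contribute equally to both sides. There are at most
  \<open>(2 ^ k)^2 = 4 ^ k\<close> exposed ones, each with \<open>2 ^ 2 ^ (s - 1)\<close> choices of
  \<open>P\<close>.\<close>

lemma accepting_difference_le:
  assumes q: "\<And>i P Q. set (queries A (cube_map a b c d i P Q)) \<subseteq> verts (cube_graph s)"
    and k: "\<And>i P Q. length (queries A (cube_map a b c d i P Q)) \<le> k"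
  shows "(\<Sum>(i, P)\<in>(SIGMA i:{..<s}. Pow (Pow ({..<s} - {i}))).
            of_bool (run A (cube_map a b c d i P (- P))) :: real)
       \<le> (\<Sum>(i, P)\<in>(SIGMA i:{..<s}. Pow (Pow ({..<s} - {i}))).
            of_bool (run A (cube_map a b c d i P P))) + 4 ^ k * 2 ^ 2 ^ (s - 1)"
proof -
  define F where "F = {cube_map a b c d i P Q | i P Q. True}"
  define U where "U = (\<Union>f\<in>F. set (queries A f))"
  have "finite U \<and> card U < 2 ^ k"
    unfolding U_def
  proof (rule card_Union_queries)
    \<comment> \<open>The two possible values at a vertex do not depend on the direction, so one
      binary decision tree covers the maps of all directions.\<close>
    show "f v \<in> {if even v then a else b, if even v then c else d}" if "f \<in> F" for f v
      using that unfolding F_def cube_map_def Let_def by auto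
  qed (use k in \<open>auto simp: F_def\<close>)
  then have finU: "finite U" and cardU: "card U \<le> 2 ^ k" by auto
  let ?B = "exposed_directions s U"
  have "card ?B \<le> card U * card U" by (rule card_exposed_directions[OF finU])
  also have "\<dots> \<le> 2 ^ k * 2 ^ k" using cardU by (intro mult_mono) auto
  finally have B: "card ?B \<le> 4 ^ k" by (simp add: power_mult_distrib[symmetric])
  have UV: "U \<subseteq> verts (cube_graph s)" using q unfolding U_def F_def by blast
  have qU: "set (queries A (cube_map a b c d i P Q)) \<subseteq> U" for i P Q unfolding U_def F_def by blast
  let ?Y = "\<lambda>i. card {P \<in> Pow (Pow ({..<s} - {i})). run A (cube_map a b c d i P (- P))}"
  let ?N = "\<lambda>i. card {P \<in> Pow (Pow ({..<s} - {i})). run A (cube_map a b c d i P P)}"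
  have le: "?Y i \<le> ?N i + (if i \<in> ?B then 2 ^ 2 ^ (s - 1) else 0)" if "i < s" for i
  proof (cases "i \<in> ?B")
    case True
    have "?Y i \<le> card (Pow (Pow ({..<s} - {i})))" by (rule card_mono) auto
    also have "\<dots> = 2 ^ 2 ^ (s - 1)" using that by (simp add: card_Pow)
    finally show ?thesis using True by simp
  next
    case False
    then show ?thesis using card_accepting_eq[OF that False UV qU] by simp
  qed
  have "(\<Sum>i<s. ?Y i) \<le> (\<Sum>i<s. ?N i + (if i \<in> ?B then 2 ^ 2 ^ (s - 1) else 0))"
    by (rule sum_mono) (use le in auto)
  also have "\<dots> = (\<Sum>i<s. ?N i) + (\<Sum>i<s. if i \<in> ?B then 2 ^ 2 ^ (s - 1) else 0)"
    by (rule sum.distrib)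
  also have "(\<Sum>i<s. if i \<in> ?B then 2 ^ 2 ^ (s - 1) else 0) = card ({..<s} \<inter> ?B) * 2 ^ 2 ^ (s - 1)"
    by (simp add: sum.inter_restrict[symmetric])
  also have "{..<s} \<inter> ?B = ?B" unfolding exposed_directions_def by auto
  also have "card ?B * 2 ^ 2 ^ (s - 1) \<le> 4 ^ k * 2 ^ 2 ^ (s - 1)" using B by simp
  finally have "(\<Sum>i<s. ?Y i) \<le> (\<Sum>i<s. ?N i) + 4 ^ k * 2 ^ 2 ^ (s - 1)" by simp
  then have "real (\<Sum>i<s. ?Y i) \<le> real ((\<Sum>i<s. ?N i) + 4 ^ k * 2 ^ 2 ^ (s - 1))"
    by (simp only: of_nat_le_iff)
  then show ?thesis unfolding sum_of_bool_directions by simp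
qed

lemma testable_imp_rectangular:
  assumes H: "finite_ugraph H" and test: "constant_query_testable H"
  shows "rectangular H"
proof (rule ccontr)
  assume "\<not> rectangular H"
  then obtain a b c d where e: "(a, b) \<in> edges H" "(b, c) \<in> edges H" "(c, d) \<in> edges H"
    and ad: "(a, d) \<notin> edges H"
    unfolding rectangular_def by blast
  obtain T :: "(nat, 'a) tester" and q where T: "lhom_tester H T" and qb: "query_bound H T q"
    using test unfolding constant_query_testable_def by blast
  have V: "{a, b, c, d} \<subseteq> verts H" using H e unfolding finite_ugraph_def by blast
  define k where "k = q (1 / 16)"
  \<comment> \<open>Acceptance averages at least 2/3 on satisfied maps and at most 1/2 on violated
    ones. Summed over directions the gap is \<open>s / 6\<close>, which must exceed the
    \<open>4 ^ k\<close> exposed directions.\<close>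
  define s where "s = 6 * 4 ^ k + (1 :: nat)"
  let ?G = "cube_graph s" and ?L = "cube_lists a b c d" and ?w = "cube_weight s"
  define M where "M = T (1 / 16) ?G ?L ?w"
  define acc where "acc f = measure_pmf.prob M {A. run A f}" for f
  have inst: "lhom_instance H ?G ?L ?w" by (rule lhom_instance_cube_graph[OF V])
  have maps: "cube_map a b c d i P Q \<in> verts ?G \<rightarrow> verts H" for i P Q
    using cube_map_in_verts[OF V] by blast
  have qs: "set (queries A (cube_map a b c d i P Q)) \<subseteq> verts ?G" if "A \<in> set_pmf M" for A i P Q
    using T inst maps that unfolding lhom_tester_def M_def by (meson zero_less_divide_1_iff zero_less_numeral)
  have ql: "length (queries A (cube_map a b c d i P Q)) \<le> k" if "A \<in> set_pmf M" for A i P Q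
    using qb inst maps that unfolding query_bound_def M_def k_def by (meson zero_less_divide_1_iff zero_less_numeral)
  define J where "J = (SIGMA i:{..<s}. Pow (Pow ({..<s} - {i})))"
  have finJ: "finite J" unfolding J_def by auto
  let ?yes = "\<lambda>(i, P). cube_map a b c d i P (- P)" and ?no = "\<lambda>(i, P). cube_map a b c d i P P"
  let ?N = "2 ^ 2 ^ (s - 1) :: real"
  have s: "s \<ge> 7" unfolding s_def by simp
  have upper: "(\<Sum>j\<in>J. acc (?yes j)) \<le> (\<Sum>j\<in>J. acc (?no j)) + 4 ^ k * ?N"
    unfolding acc_def
  proof (rule sum_prob_le_of_pointwise[OF finJ])
    fix A assume "A \<in> set_pmf M"
    from accepting_difference_le[of A a b c d s k, OF qs[OF this] ql[OF this]]
    show "(\<Sum>j\<in>J. of_bool (run A (?yes j))) \<le> (\<Sum>j\<in>J. of_bool (run A (?no j))) + 4 ^ k * ?N"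
      unfolding J_def by (simp add: case_prod_unfold)
  qed
  have cardP: "card (Pow ({..<s} - {i})) = 2 ^ (s - 1)" if "i < s" for i
    using that by (simp add: card_Pow)
  have yes: "(\<Sum>P\<in>Pow (Pow ({..<s} - {i})). acc (cube_map a b c d i P (- P))) \<ge> 2 / 3 * ?N"
    if "i < s" for i
  proof -
    have "2 / 3 * ?N = (\<Sum>P\<in>Pow (Pow ({..<s} - {i})). 2 / 3)"
      using cardP[OF that] by (simp add: card_Pow)
    also have "\<dots> \<le> (\<Sum>P\<in>Pow (Pow ({..<s} - {i})). acc (cube_map a b c d i P (- P)))"
    proof (rule sum_mono)
      fix P assume "P \<in> Pow (Pow ({..<s} - {i}))"
      then have "list_hom H ?G ?L (cube_map a b c d i P (- P))"
        by (intro list_hom_cube_map[OF H e]) auto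
      then show "2 / 3 \<le> acc (cube_map a b c d i P (- P))"
        using T inst maps unfolding lhom_tester_def M_def acc_def
        by (meson zero_less_divide_1_iff zero_less_numeral)
    qed
    finally show ?thesis .
  qed
  \<comment> \<open>The extra 1/6 pays for the sets \<open>P\<close> with fewer than a quarter of
    the matching edges, whose maps need not be far; there acceptance is only bounded by 1.\<close>
  have no: "(\<Sum>P\<in>Pow (Pow ({..<s} - {i})). acc (cube_map a b c d i P P)) \<le> (1 / 3 + 1 / 6) * ?N"
    if i: "i < s" for i
  proof -
    let ?S = "Pow ({..<s} - {i})"
    let ?B = "{P \<in> Pow ?S. 4 * card P < card ?S}"
    have "(\<Sum>P\<in>Pow ?S. acc (cube_map a b c d i P P)) \<le> (\<Sum>P\<in>Pow ?S. 1 / 3 + of_bool (P \<in> ?B))"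
    proof (rule sum_mono)
      fix P assume P: "P \<in> Pow ?S"
      have le1: "acc f \<le> 1" for f unfolding acc_def by simp
      show "acc (cube_map a b c d i P P) \<le> 1 / 3 + of_bool (P \<in> ?B)"
      proof (cases "P \<in> ?B")
        case False
        then have "2 ^ (s - 1) \<le> 4 * card P" using P cardP[OF i] by auto
        then have "2 * 2 ^ (s - 1) \<le> 8 * card P" by simp
        moreover have "2 * 2 ^ (s - 1) = (2::nat) ^ s" using s by (simp add: power_eq_if)
        ultimately have "far_from_hom H ?G ?L ?w (1 / 16) (cube_map a b c d i P P)"
          using P i by (intro far_cube_map[OF ad]) auto
        then have "2 / 3 \<le> measure_pmf.prob M {A. \<not> run A (cube_map a b c d i P P)}"
          using T inst maps unfolding lhom_tester_def M_def
          by (meson zero_less_divide_1_iff zero_less_numeral)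
        also have "\<dots> = 1 - acc (cube_map a b c d i P P)"
          unfolding acc_def using measure_pmf.prob_compl[of "{A. run A (cube_map a b c d i P P)}" M]
          by (simp add: Compl_eq_Diff_UNIV[symmetric] Collect_neg_eq)
        finally show ?thesis using False by simp
      qed (use le1[of "cube_map a b c d i P P"] in simp)
    qed
    also have "\<dots> = 1 / 3 * ?N + real (card ?B)"
      using cardP[OF i] by (simp add: sum.distrib card_Pow Int_def)
    also have "real (card ?B) \<le> 4 / 2 ^ (s - 1) * ?N"
      using card_small_subsets_le[OF _ Pow_not_empty, of "{..<s} - {i}"] cardP[OF i] by simp
    also have "\<dots> \<le> 1 / 6 * ?N"
    proof (rule mult_right_mono)
      have "(2::real) ^ 6 \<le> 2 ^ (s - 1)" using s by (intro power_increasing) auto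
      then show "4 / 2 ^ (s - 1) \<le> (1 / 6 :: real)" by (simp add: field_simps)
    qed simp
    finally show ?thesis by (simp add: algebra_simps)
  qed
  have split: "(\<Sum>j\<in>J. F j) = (\<Sum>i<s. \<Sum>P\<in>Pow (Pow ({..<s} - {i})). F (i, P))"
    for F :: "nat \<times> nat set set \<Rightarrow> real"
    unfolding J_def by (subst sum.Sigma) auto
  have "real s * (2 / 3 * ?N) = (\<Sum>i<s. 2 / 3 * ?N)" by simp
  also have "\<dots> \<le> (\<Sum>j\<in>J. acc (?yes j))"
    unfolding split by (rule sum_mono) (use yes in simp)
  also note upper
  also have "(\<Sum>j\<in>J. acc (?no j)) \<le> (\<Sum>i<s. (1 / 3 + 1 / 6) * ?N)"
    unfolding split by (rule sum_mono) (use no in simp)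
  also have "\<dots> = real s * ((1 / 3 + 1 / 6) * ?N)" by simp
  finally have "(real s * (2 / 3)) * ?N \<le> (real s * (1 / 3 + 1 / 6) + 4 ^ k) * ?N"
    by (simp add: algebra_simps)
  then have "real s * (2 / 3) \<le> real s * (1 / 3 + 1 / 6) + 4 ^ k"
    by (rule mult_right_le_imp_le) simp
  then show False unfolding s_def by simp
qed

theorem theorem1:
  fixes H :: "'h ugraph"
  assumes "finite_ugraph H"
  shows "((irreflexive_graph H \<and> complete_bipartite_graph H) \<or> (reflexive_graph H \<and> complete_ugraph H)
            \<longrightarrow> constant_query_testable H) \<and>
         (connected_graph H \<longrightarrow> constant_query_testable H \<longrightarrow>
            (irreflexive_graph H \<and> complete_bipartite_graph H) \<or> (reflexive_graph H \<and> complete_ugraph H))"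
  using assms complete_bipartite_imp_rectangular reflexive_complete_imp_rectangular
    rectangular_imp_testable testable_imp_rectangular connected_rectangular_classification
  by blast

end
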